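(* For $n\ge2$ and $0\le k\le n$ let $T(n,k)=(n+1)^{k-1}\binom{2n-k}{n}$. Then for every $n\ge2$ the sequence $T(n,n),T(n,n-1),\ldots,T(n,0)$ is log-concave.
   Context: A sequence $s_0,\ldots,s_N$ of nonnegative integers is log-concave if $s_i^2\ge s_{i-1}s_{i+1}$ for $0<i<N$. (The numbers $T(n,k)$ are nonnegative integers, the entries of the "parking triangle".) *)

theory Defs
  imports Complex_Main
begin

text \<open>Log-concavity of a finite sequence \<open>s 0, \<dots>, s N\<close>; the entries are taken in the rationals
  because the formula for the parking triangle below has the exponent \<open>-1\<close> for \<open>k = 0\<close>.\<close>

definition log_concave :: "nat \<Rightarrow> (nat \<Rightarrow> rat) \<Rightarrow> bool" where
  "log_concave N s \<longleftrightarrow> (\<forall>i. 0 < i \<and> i < N \<longrightarrow> (s i)\<^sup>2 \<ge> s (i - 1) * s (i + 1))"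

text \<open>The parking triangle; only the range \<open>k \<le> n\<close> is meaningful, and there the
  subtraction \<open>2 * n - k\<close> is not truncated.\<close>

definition parking_T :: "nat \<Rightarrow> nat \<Rightarrow> rat" where
  "parking_T n k = of_nat (n + 1) powi (int k - 1) * of_nat ((2 * n - k) choose n)"

text \<open>The entries are nonnegative integers; for \<open>k = 0\<close> they are the Catalan numbers.\<close>

lemma parking_T_in_Nats: "parking_T n k \<in> \<nat>"
proof (cases k)
  case 0
  have "Suc n * ((2 * n) choose Suc n) = n * ((2 * n) choose n)"
    using binomial_absorb_comp[of "2 * n" n] binomial_absorption[of n "2 * n"]
    by (cases n) (simp_all add: binomial_absorption)
  then have e: "(of_nat (Suc n) :: rat) * of_nat ((2 * n) choose Suc n)
      = of_nat n * of_nat ((2 * n) choose n)"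
    by (metis of_nat_mult)
  have "Suc n * ((2 * n) choose Suc n) \<le> Suc n * ((2 * n) choose n)"
    using \<open>Suc n * _ = _\<close> by simp
  then have le: "((2 * n) choose Suc n) \<le> ((2 * n) choose n)"
    by (simp only: Suc_mult_le_cancel1)
  have "parking_T n k = of_nat ((2 * n) choose n) / of_nat (Suc n)"
    using 0 by (simp add: parking_T_def power_int_minus field_simps)
  also have "\<dots> = of_nat (((2 * n) choose n) - ((2 * n) choose Suc n))"
    using e le by (simp add: of_nat_diff field_simps)
  finally show ?thesis by simp
next
  case (Suc j)
  then have "parking_T n k = of_nat ((n + 1) ^ j * ((2 * n - k) choose n))"
    by (simp add: parking_T_def)
  then show ?thesis by (metis of_nat_in_Nats)
qed

end

theory Submission
  imports Defs
begin

text \<open>Reindexed by \<open>k = n - i\<close>, the entry is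
  \<open>(n+1)^(n-i-1) * ((n+i) choose n)\<close>: a geometric factor times a binomial coefficient
  whose upper index grows with i. Geometric sequences satisfy log-concavity with equality, so the
  claim reduces to log-concavity of binomials in the upper index, which is
  \<open>binomial_upper_log_concave\<close>.\<close>

text \<open>For \<open>k \<le> m\<close> the quotient of consecutive terms is
  \<open>(m+1) / (m+1-k) = 1 + k / (m+1-k)\<close>, which decreases as m grows.\<close>

lemma binomial_upper_log_concave:
  "(m choose k) * (Suc (Suc m) choose k) \<le> (Suc m choose k)\<^sup>2"
proof (cases "k \<le> m")
  case True
  then obtain j where m: "m = k + j"
    using le_Suc_ex by blast
  define a b c where "a = (m choose k)" and "b = (Suc m choose k)" and "c = (Suc (Suc m) choose k)"
  have ab: "Suc j * b = Suc m * a"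
    using binomial_absorb_comp[of "Suc m" k] by (simp add: m a_def b_def Suc_diff_le)
  have bc: "Suc (Suc j) * c = Suc (Suc m) * b"
    using binomial_absorb_comp[of "Suc (Suc m)" k] by (simp add: m b_def c_def Suc_diff_le)
  have "(Suc m * Suc (Suc j)) * (a * c) = (Suc m * a) * (Suc (Suc j) * c)"
    by (simp only: mult_ac)
  also have "\<dots> = (Suc j * b) * (Suc (Suc m) * b)"
    by (simp only: ab bc)
  also have "\<dots> = (Suc j * Suc (Suc m)) * b\<^sup>2"
    by (simp only: power2_eq_square mult_ac)
  \<comment> \<open>The two coefficients differ by exactly \<open>m - j = k\<close>.\<close>
  also have "\<dots> \<le> (Suc m * Suc (Suc j)) * b\<^sup>2"
    by (intro mult_right_mono) (simp_all add: m)
  finally show ?thesis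
    unfolding a_def b_def c_def by (simp only: mult_le_cancel1) simp
qed (simp add: binomial_eq_0)

theorem corollary7p8:
  fixes n :: nat
  assumes "n \<ge> 2"
  shows "log_concave n (\<lambda>i. parking_T n (n - i))"
  unfolding log_concave_def
proof (intro allI impI)
  fix i
  assume "0 < i \<and> i < n"
  then have i: "0 < i" "i < n"
    by simp_all
  define q :: rat where "q = of_nat (n + 1)"
  define e :: int where "e = int (n - i) - 1"
  define B :: "nat \<Rightarrow> rat" where "B j = of_nat ((n + j) choose n)" for j
  have T: "parking_T n (n - j) = q powi (int (n - j) - 1) * B j" if "j \<le> n" for j
    using that by (simp add: parking_T_def q_def B_def mult_2)
  \<comment> \<open>At \<open>i = n - 1\<close> the exponent \<open>e - 1\<close> is -1 (the Catalan
    entry), so powers are integer powers and splitting their exponents calls for a nonzero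
    base.\<close>
  have "q \<noteq> 0"
    unfolding q_def by (simp only: of_nat_eq_0_iff)
  then have pow: "q powi (e + 1) * q powi (e - 1) = (q powi e)\<^sup>2"
    by (simp add: power_int_add power_int_diff power2_eq_square)
  have "B (i - 1) * B (i + 1) \<le> (B i)\<^sup>2"
  proof -
    have "((n + (i - 1)) choose n) * ((n + (i + 1)) choose n) \<le> ((n + i) choose n)\<^sup>2"
      \<comment> \<open>Since \<open>0 < i\<close>, the subtraction is not truncated and the three
        upper indices are consecutive.\<close>
      using binomial_upper_log_concave[of "n + (i - 1)" n] i by simp
    then show ?thesis
      unfolding B_def by (simp only: of_nat_mult[symmetric] of_nat_power[symmetric] of_nat_le_iff)
  qed
  then have "(q powi e)\<^sup>2 * (B (i - 1) * B (i + 1)) \<le> (q powi e)\<^sup>2 * (B i)\<^sup>2"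
    by (intro mult_left_mono) simp_all
  moreover have "parking_T n (n - (i - 1)) = q powi (e + 1) * B (i - 1)"
    "parking_T n (n - i) = q powi e * B i"
    "parking_T n (n - (i + 1)) = q powi (e - 1) * B (i + 1)"
    using T[of "i - 1"] T[of i] T[of "i + 1"] i by (simp_all add: e_def of_nat_diff algebra_simps)
  ultimately show "parking_T n (n - (i - 1)) * parking_T n (n - (i + 1)) \<le> (parking_T n (n - i))\<^sup>2"
    by (simp only: pow[symmetric] power_mult_distrib mult_ac)
qed

end
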